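(* Let $G$ be a finite cyclic group, let $k\in \mathbb N$, and let $S$ be a zero-sum sequence over $G$ of length $\mathsf D_k(G)$. Then $S\in \mathcal M_k(G)$ if and only if there exists $g\in G$ with $\ord(g)=|G|$ such that $S=g^{k|G|}$.
   Context: A sequence over $G$ is a finite unordered sequence of elements of $G$ with repetition allowed, written multiplicatively ($g^m$ is $m$ copies of $g$); it is zero-sum if its terms sum to $0$. $\mathsf D_k(G)$ is the smallest integer $\ell$ such that every sequence over $G$ of length at least $\ell$ has $k$ disjoint nontrivial zero-sum subsequences. $\mathcal M_k(G)$ is the set of zero-sum sequences over $G$ that cannot be partitioned into $k+1$ nontrivial zero-sum subsequences. *)

theory Defs
  imports "HOL-Library.Multiset" "HOL-Algebra.Multiplicative_Group" "HOL-Algebra.Elementary_Groups"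
begin

text \<open>
  Groups are written multiplicatively here, as in HOL-Algebra, so that ``sum'' means product and
  \<open>0\<close> is \<open>\<one>\<close>. Sequences are multisets over the carrier; the trivial sequence is \<open>{#}\<close>.
\<close>

definition seq_over :: "('a, 'b) monoid_scheme \<Rightarrow> 'a multiset \<Rightarrow> bool" where
  "seq_over G S \<longleftrightarrow> set_mset S \<subseteq> carrier G"

definition seq_sum :: "('a, 'b) monoid_scheme \<Rightarrow> 'a multiset \<Rightarrow> 'a" where
  "seq_sum G S = finprod G (\<lambda>g. g [^]\<^bsub>G\<^esub> count S g) (set_mset S)"

definition zero_sum :: "('a, 'b) monoid_scheme \<Rightarrow> 'a multiset \<Rightarrow> bool" where
  "zero_sum G S \<longleftrightarrow> seq_over G S \<and> seq_sum G S = \<one>\<^bsub>G\<^esub>"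

text \<open>
  A family of \<open>k\<close> subsequences is a multiset of multisets (the same subsequence may be repeated).
  Its members are disjoint subsequences of \<open>S\<close> iff their multiset sum is contained in \<open>S\<close>, and
  they partition \<open>S\<close> iff it equals \<open>S\<close>.
\<close>

definition nontrivial_zero_sums ::
    "('a, 'b) monoid_scheme \<Rightarrow> nat \<Rightarrow> 'a multiset multiset \<Rightarrow> bool" where
  "nontrivial_zero_sums G k \<T> \<longleftrightarrow> size \<T> = k \<and> (\<forall>T\<in>#\<T>. T \<noteq> {#} \<and> zero_sum G T)"

definition Davenport :: "('a, 'b) monoid_scheme \<Rightarrow> nat \<Rightarrow> nat" where
  "Davenport G k =
    (LEAST l. \<forall>S. seq_over G S \<and> l \<le> size S \<longrightarrow>
       (\<exists>\<T>. nontrivial_zero_sums G k \<T> \<and> \<Sum>\<^sub># \<T> \<subseteq># S))"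

definition M_set :: "('a, 'b) monoid_scheme \<Rightarrow> nat \<Rightarrow> 'a multiset set" where
  "M_set G k =
    {S. zero_sum G S \<and> \<not> (\<exists>\<T>. nontrivial_zero_sums G (k + 1) \<T> \<and> \<Sum>\<^sub># \<T> = S)}"

lemma seq_sum_empty [simp]: "comm_group G \<Longrightarrow> seq_sum G {#} = \<one>\<^bsub>G\<^esub>"
  by (simp add: seq_sum_def comm_group_def comm_monoid.finprod_empty)

lemma seq_sum_add_mset:
  assumes "comm_group G" "seq_over G S" "g \<in> carrier G"
  shows "seq_sum G (add_mset g S) = g \<otimes>\<^bsub>G\<^esub> seq_sum G S"
proof -
  interpret comm_group G by fact
  have sub: "set_mset S \<subseteq> carrier G" using assms(2) by (simp add: seq_over_def)
  define A where "A = set_mset S - {g}"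
  have A: "finite A" "g \<notin> A" "A \<subseteq> carrier G" using sub by (auto simp: A_def)
  have split: "seq_sum G T = (g [^]\<^bsub>G\<^esub> count T g) \<otimes>\<^bsub>G\<^esub> finprod G (\<lambda>h. h [^]\<^bsub>G\<^esub> count S h) A"
    if T: "set_mset T \<subseteq> insert g A" "A \<subseteq> set_mset T" "\<And>h. h \<in> A \<Longrightarrow> count T h = count S h" for T
  proof -
    have "seq_sum G T = finprod G (\<lambda>h. h [^]\<^bsub>G\<^esub> count T h) (insert g A)"
      unfolding seq_sum_def
      by (rule finprod_mono_neutral_cong_left)
         (use A T assms(3) in \<open>auto simp: not_in_iff\<close>)
    also have "\<dots> = (g [^]\<^bsub>G\<^esub> count T g) \<otimes>\<^bsub>G\<^esub> finprod G (\<lambda>h. h [^]\<^bsub>G\<^esub> count T h) A"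
      by (rule finprod_insert) (use A assms(3) in auto)
    also have "finprod G (\<lambda>h. h [^]\<^bsub>G\<^esub> count T h) A = finprod G (\<lambda>h. h [^]\<^bsub>G\<^esub> count S h) A"
      by (rule finprod_cong') (use A T in auto)
    finally show ?thesis .
  qed
  have P: "finprod G (\<lambda>h. h [^]\<^bsub>G\<^esub> count S h) A \<in> carrier G"
    by (rule finprod_closed) (use A in auto)
  have 1: "seq_sum G (add_mset g S) =
      (g [^]\<^bsub>G\<^esub> Suc (count S g)) \<otimes>\<^bsub>G\<^esub> finprod G (\<lambda>h. h [^]\<^bsub>G\<^esub> count S h) A"
    by (subst split) (auto simp: A_def)
  have 2: "seq_sum G S = (g [^]\<^bsub>G\<^esub> count S g) \<otimes>\<^bsub>G\<^esub> finprod G (\<lambda>h. h [^]\<^bsub>G\<^esub> count S h) A"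
    by (rule split) (auto simp: A_def)
  show ?thesis
    unfolding 1 2 using assms(3) P by (simp add: m_ac)
qed

end

theory Submission
  imports Defs
begin

text \<open>
  Let \<open>n = |G|\<close>. Two of the \<open>n + 1\<close> prefix sums of any \<open>n\<close> terms coincide, so there is a
  nontrivial zero-sum subsequence of length at most \<open>n\<close>. Removing such subsequences greedily gives
  \<open>D\<^sub>k(G) \<le> k n\<close>, and the sequences \<open>g\<^sup>m\<close> for a generator \<open>g\<close> show equality. A family of \<open>k\<close>
  disjoint nontrivial zero-sum subsequences of some \<open>S\<close> in \<open>M\<^sub>k(G)\<close> must exhaust \<open>S\<close>, since the
  rest of \<open>S\<close> would be a further part; a greedy family starting with \<open>T\<close> therefore shows
  \<open>|S| \<le> |T| + (k - 1) n\<close>. So if \<open>|S| = k n\<close>, then \<open>S\<close> has no nontrivial zero-sum subsequence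
  shorter than \<open>n\<close>, and the \<open>n\<close> prefix sums of length less than \<open>n\<close> of any arrangement of \<open>S\<close>
  enumerate \<open>G\<close>. Swapping the first two terms \<open>g, h\<close> changes only one prefix sum, namely \<open>g\<close>
  into \<open>h\<close>; hence \<open>g = h\<close>.
\<close>

lemma seq_over_empty [simp]: "seq_over G {#}"
  by (simp add: seq_over_def)

lemma seq_over_add_mset [simp]: "seq_over G (add_mset g S) \<longleftrightarrow> g \<in> carrier G \<and> seq_over G S"
  by (simp add: seq_over_def)

lemma seq_over_union [simp]: "seq_over G (S + T) \<longleftrightarrow> seq_over G S \<and> seq_over G T"
  by (simp add: seq_over_def)

lemma seq_over_mono: "T \<subseteq># S \<Longrightarrow> seq_over G S \<Longrightarrow> seq_over G T"
  by (auto simp: subset_mset.le_iff_add)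

lemma nontrivial_zero_sums_0 [simp]: "nontrivial_zero_sums G 0 \<T> \<longleftrightarrow> \<T> = {#}"
  by (auto simp: nontrivial_zero_sums_def)

lemma nontrivial_zero_sums_add_mset [simp]:
  "nontrivial_zero_sums G (Suc k) (add_mset T \<T>) \<longleftrightarrow>
    T \<noteq> {#} \<and> zero_sum G T \<and> nontrivial_zero_sums G k \<T>"
  by (auto simp: nontrivial_zero_sums_def)

definition no_short_zero_sum :: "('a, 'b) monoid_scheme \<Rightarrow> nat \<Rightarrow> 'a multiset \<Rightarrow> bool" where
  "no_short_zero_sum G n S \<longleftrightarrow> (\<forall>T. T \<subseteq># S \<longrightarrow> T \<noteq> {#} \<longrightarrow> zero_sum G T \<longrightarrow> n \<le> size T)"

lemma no_short_zero_sumD: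
  "no_short_zero_sum G n S \<Longrightarrow> T \<subseteq># S \<Longrightarrow> T \<noteq> {#} \<Longrightarrow> zero_sum G T \<Longrightarrow> n \<le> size T"
  by (simp add: no_short_zero_sum_def)

lemma nontrivial_zero_sums_size_ge:
  assumes "no_short_zero_sum G n S" "nontrivial_zero_sums G k \<T>" "\<Sum>\<^sub># \<T> \<subseteq># S"
  shows "k * n \<le> size S"
proof -
  have "n \<le> size T" if "T \<in># \<T>" for T
  proof (rule no_short_zero_sumD[OF assms(1)])
    have "T \<subseteq># \<Sum>\<^sub># \<T>" using that by (auto dest: multi_member_split)
    then show "T \<subseteq># S" using assms(3) by (rule subset_mset.order_trans)
  qed (use assms(2) that in \<open>auto simp: nontrivial_zero_sums_def\<close>)
  then have "size \<T> * n \<le> size (\<Sum>\<^sub># \<T>)"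
    by (induction \<T>) (simp_all add: add_mono)
  also have "\<dots> \<le> size S" using assms(3) by (rule size_mset_mono)
  finally show ?thesis using assms(2) by (simp add: nontrivial_zero_sums_def)
qed

lemma M_setI_no_short_zero_sum:
  assumes "zero_sum G S" "no_short_zero_sum G n S" "size S < (k + 1) * n"
  shows "S \<in> M_set G k"
  using assms nontrivial_zero_sums_size_ge[OF assms(2), of "k + 1"]
  by (fastforce simp: M_set_def)

definition prefix_sum :: "('a, 'b) monoid_scheme \<Rightarrow> 'a list \<Rightarrow> nat \<Rightarrow> 'a" where
  "prefix_sum G xs i = seq_sum G (mset (take i xs))"

lemma prefix_sum_swap_first_two:
  "i \<noteq> 1 \<Longrightarrow> prefix_sum G (h # g # xs) i = prefix_sum G (g # h # xs) i"
  by (cases i; cases "i - 1") (simp_all add: prefix_sum_def add_mset_commute)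

context comm_group
begin

lemma seq_sum_closed [simp]: "seq_over G S \<Longrightarrow> seq_sum G S \<in> carrier G"
  unfolding seq_over_def seq_sum_def by (rule finprod_closed) auto

lemma seq_sum_union:
  assumes "seq_over G S" "seq_over G T"
  shows "seq_sum G (S + T) = seq_sum G S \<otimes> seq_sum G T"
  using assms
  by (induction S) (simp_all add: seq_sum_add_mset comm_group_axioms m_assoc)

lemma seq_sum_replicate_mset: "g \<in> carrier G \<Longrightarrow> seq_sum G (replicate_mset m g) = g [^] m"
  by (cases m) (simp_all add: seq_sum_def)

lemma zero_sum_replicate_mset_iff:
  "g \<in> carrier G \<Longrightarrow> zero_sum G (replicate_mset m g) \<longleftrightarrow> ord g dvd m"
  by (simp add: zero_sum_def seq_over_def seq_sum_replicate_mset pow_eq_id)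

lemma zero_sum_union: "zero_sum G S \<Longrightarrow> zero_sum G T \<Longrightarrow> zero_sum G (S + T)"
  by (simp add: zero_sum_def seq_sum_union)

lemma zero_sum_diff:
  assumes "zero_sum G S" "zero_sum G T" "T \<subseteq># S"
  shows "zero_sum G (S - T)"
proof -
  obtain R where "S = T + R" using assms(3) by (auto simp: subset_mset.le_iff_add)
  then show ?thesis using assms(1,2) by (auto simp: zero_sum_def seq_sum_union)
qed

lemma zero_sum_Sum_mset:
  "(\<And>T. T \<in># \<T> \<Longrightarrow> zero_sum G T) \<Longrightarrow> zero_sum G (\<Sum>\<^sub># \<T>)"
proof (induction \<T>)
  case empty
  then show ?case by (simp add: zero_sum_def comm_group_axioms)
next
  case (add T \<T>)
  then show ?case by (simp add: zero_sum_union)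
qed

lemma no_short_zero_sum_replicate_mset_iff:
  assumes g: "g \<in> carrier G" "0 < ord g"
  shows "no_short_zero_sum G n (replicate_mset m g) \<longleftrightarrow> n \<le> ord g \<or> m < ord g"
proof
  assume "no_short_zero_sum G n (replicate_mset m g)"
  from no_short_zero_sumD[OF this, of "replicate_mset (ord g) g"]
  show "n \<le> ord g \<or> m < ord g"
    using g by (auto simp: replicate_mset_msubseteq_iff zero_sum_replicate_mset_iff)
next
  assume n: "n \<le> ord g \<or> m < ord g"
  show "no_short_zero_sum G n (replicate_mset m g)"
    unfolding no_short_zero_sum_def
  proof (intro allI impI)
    fix T assume T: "T \<subseteq># replicate_mset m g" "T \<noteq> {#}" "zero_sum G T"
    obtain l where l: "l \<le> m" "T = replicate_mset l g"
      using T(1) by (rule msubseteq_replicate_msetE)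
    then have "ord g \<le> l"
      using T(2,3) g(1) by (auto simp: zero_sum_replicate_mset_iff intro: dvd_imp_le)
    then show "n \<le> size T" using n l by auto
  qed
qed

lemma prefix_sum_closed: "set xs \<subseteq> carrier G \<Longrightarrow> prefix_sum G xs i \<in> carrier G"
  unfolding prefix_sum_def
  by (rule seq_sum_closed) (auto simp: seq_over_def dest: in_set_takeD)

lemma prefix_sum_Cons_1: "g \<in> carrier G \<Longrightarrow> prefix_sum G (g # xs) 1 = g"
  by (simp add: prefix_sum_def seq_sum_add_mset comm_group_axioms)

lemma prefix_sum_eq_iff_zero_sum:
  assumes xs: "set xs \<subseteq> carrier G" and "i \<le> j"
  shows "prefix_sum G xs i = prefix_sum G xs j \<longleftrightarrow> zero_sum G (mset (drop i (take j xs)))"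
proof -
  have over: "seq_over G (mset (take i xs))" "seq_over G (mset (drop i (take j xs)))"
    using xs by (auto simp: seq_over_def dest!: in_set_takeD in_set_dropD)
  have "take j xs = take i xs @ drop i (take j xs)"
    using append_take_drop_id[of i "take j xs"] \<open>i \<le> j\<close> by (simp add: min_def)
  then have "prefix_sum G xs j = prefix_sum G xs i \<otimes> seq_sum G (mset (drop i (take j xs)))"
    unfolding prefix_sum_def by (metis mset_append seq_sum_union over)
  then show ?thesis
    using over by (auto simp: zero_sum_def prefix_sum_def)
qed

lemma inj_on_prefix_sum:
  assumes xs: "set xs \<subseteq> carrier G" and free: "no_short_zero_sum G n (mset xs)"
    and len: "n \<le> Suc (length xs)"
  shows "inj_on (prefix_sum G xs) {..<n}"
proof (rule linorder_inj_onI)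
  fix i j assume ij: "i < j" "i \<in> {..<n}" "j \<in> {..<n}"
  let ?T = "mset (drop i (take j xs))"
  have "?T \<subseteq># mset xs"
    by (metis append_take_drop_id mset_append mset_subset_eq_add_left mset_subset_eq_add_right
        subset_mset.order_trans)
  moreover have "?T \<noteq> {#}" "size ?T < n" using ij len by auto
  ultimately have "\<not> zero_sum G ?T" using no_short_zero_sumD[OF free] by fastforce
  then show "prefix_sum G xs i \<noteq> prefix_sum G xs j"
    using prefix_sum_eq_iff_zero_sum[OF xs] ij by simp
qed auto

lemma prefix_sum_image_eq_carrier:
  assumes fin: "finite (carrier G)" and xs: "set xs \<subseteq> carrier G"
    and inj: "inj_on (prefix_sum G xs) {..<order G}"
  shows "prefix_sum G xs ` {..<order G} = carrier G"
  using prefix_sum_closed[OF xs] fin inj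
  by (intro card_subset_eq) (auto simp: card_image order_def)

lemma no_short_zero_sum_le_order:
  assumes fin: "finite (carrier G)" and S: "seq_over G S"
    and free: "no_short_zero_sum G n S" and size: "n \<le> Suc (size S)"
  shows "n \<le> order G"
proof -
  obtain xs where xs: "mset xs = S" by (metis ex_mset)
  then have set: "set xs \<subseteq> carrier G" using S by (auto simp: seq_over_def)
  have "inj_on (prefix_sum G xs) {..<n}"
    using inj_on_prefix_sum[OF set] free size xs by auto
  moreover have "prefix_sum G xs ` {..<n} \<subseteq> carrier G"
    using prefix_sum_closed[OF set] by blast
  ultimately have "card {..<n} \<le> card (carrier G)"
    using fin by (intro card_inj_on_le)
  then show ?thesis by (simp add: order_def)
qed

lemma short_zero_sum_exists:
  assumes "finite (carrier G)" "seq_over G S" "order G \<le> size S"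
  obtains T where "T \<subseteq># S" "T \<noteq> {#}" "zero_sum G T" "size T \<le> order G"
proof -
  have "\<not> no_short_zero_sum G (Suc (order G)) S"
    using no_short_zero_sum_le_order[OF assms(1,2), of "Suc (order G)"] assms(3) by auto
  then show thesis using that by (auto simp: no_short_zero_sum_def not_less_eq_eq)
qed

lemma disjoint_zero_sums_exist:
  assumes fin: "finite (carrier G)" and "seq_over G S" "k * order G \<le> size S"
  shows "\<exists>\<T>. nontrivial_zero_sums G k \<T> \<and> \<Sum>\<^sub># \<T> \<subseteq># S \<and> size (\<Sum>\<^sub># \<T>) \<le> k * order G"
  using assms(2,3)
proof (induction k arbitrary: S)
  case 0
  show ?case by simp
next
  case (Suc k)
  obtain T where T: "T \<subseteq># S" "T \<noteq> {#}" "zero_sum G T" "size T \<le> order G"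
    using short_zero_sum_exists[OF fin Suc.prems(1)] Suc.prems(2) by auto
  have "seq_over G (S - T)" using Suc.prems(1) by (rule seq_over_mono[rotated]) simp
  moreover have "k * order G \<le> size (S - T)"
    using Suc.prems(2) T by (simp add: size_Diff_submset)
  ultimately obtain \<T> where \<T>: "nontrivial_zero_sums G k \<T>" "\<Sum>\<^sub># \<T> \<subseteq># S - T"
      "size (\<Sum>\<^sub># \<T>) \<le> k * order G"
    using Suc.IH by blast
  have "T + \<Sum>\<^sub># \<T> \<subseteq># S"
    using \<T>(2) T(1) by (metis subset_mset.le_diff_conv2 add.commute)
  then show ?case
    using \<T> T by (intro exI[of _ "add_mset T \<T>"]) auto
qed

lemma Davenport_le:
  assumes "finite (carrier G)"
  shows "Davenport G k \<le> k * order G"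
  unfolding Davenport_def
  by (rule Least_le) (use disjoint_zero_sums_exist[OF assms] in blast)

lemma disjoint_zero_sums_of_Davenport_le:
  assumes "finite (carrier G)" "seq_over G S" "Davenport G k \<le> size S"
  shows "\<exists>\<T>. nontrivial_zero_sums G k \<T> \<and> \<Sum>\<^sub># \<T> \<subseteq># S"
proof -
  let ?P = "\<lambda>l. \<forall>S. seq_over G S \<and> l \<le> size S \<longrightarrow>
    (\<exists>\<T>. nontrivial_zero_sums G k \<T> \<and> \<Sum>\<^sub># \<T> \<subseteq># S)"
  have "?P (k * order G)" using disjoint_zero_sums_exist[OF assms(1)] by blast
  then have "?P (Davenport G k)" unfolding Davenport_def by (rule LeastI)
  then show ?thesis using assms(2,3) by blast
qed

lemma Davenport_ge_mult_ord:
  assumes fin: "finite (carrier G)" and g: "g \<in> carrier G"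
  shows "k * ord g \<le> Davenport G k"
proof -
  let ?S = "replicate_mset (Davenport G k) g"
  have "0 < ord g" using ord_ge_1[OF fin g] by simp
  then have "no_short_zero_sum G (ord g) ?S"
    using g by (simp add: no_short_zero_sum_replicate_mset_iff)
  moreover have "seq_over G ?S" using g by (simp add: seq_over_def)
  then obtain \<T> where "nontrivial_zero_sums G k \<T>" "\<Sum>\<^sub># \<T> \<subseteq># ?S"
    using disjoint_zero_sums_of_Davenport_le[OF fin] by fastforce
  ultimately have "k * ord g \<le> size ?S" by (rule nontrivial_zero_sums_size_ge)
  then show ?thesis by simp
qed

lemma Davenport_cyclic_group:
  assumes fin: "finite (carrier G)" and "cyclic_group G"
  shows "Davenport G k = k * order G"
proof (rule antisym[OF Davenport_le[OF fin]])
  obtain g where "g \<in> carrier G" "ord g = order G"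
    using assms(2) cyclic_order_is_ord by (metis cyclic_group_def)
  then show "k * order G \<le> Davenport G k" using Davenport_ge_mult_ord[OF fin] by metis
qed

lemma M_set_disjoint_zero_sums_exhaust:
  assumes S: "S \<in> M_set G k" and \<T>: "nontrivial_zero_sums G k \<T>" "\<Sum>\<^sub># \<T> \<subseteq># S"
  shows "\<Sum>\<^sub># \<T> = S"
proof (rule ccontr)
  let ?R = "S - \<Sum>\<^sub># \<T>"
  assume "\<Sum>\<^sub># \<T> \<noteq> S"
  then have "?R \<noteq> {#}" using \<T>(2) by (metis Diff_eq_empty_iff_mset subset_mset.antisym)
  moreover have "zero_sum G (\<Sum>\<^sub># \<T>)"
    using \<T>(1) by (intro zero_sum_Sum_mset) (simp add: nontrivial_zero_sums_def)
  then have "zero_sum G ?R" using S \<T>(2) by (simp add: M_set_def zero_sum_diff)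
  ultimately have "nontrivial_zero_sums G (k + 1) (add_mset ?R \<T>)" using \<T>(1) by simp
  moreover have "\<Sum>\<^sub># (add_mset ?R \<T>) = S" using \<T>(2) by simp
  ultimately show False using S unfolding M_set_def by blast
qed

lemma M_set_size_le:
  assumes fin: "finite (carrier G)" and S: "S \<in> M_set G (Suc k)"
    and T: "T \<subseteq># S" "T \<noteq> {#}" "zero_sum G T"
  shows "size S \<le> size T + k * order G"
proof (cases "k * order G \<le> size (S - T)")
  case True
  have "seq_over G (S - T)"
    using S by (intro seq_over_mono[of "S - T" S]) (auto simp: M_set_def zero_sum_def)
  with True obtain \<T> where \<T>: "nontrivial_zero_sums G k \<T>" "\<Sum>\<^sub># \<T> \<subseteq># S - T"
      "size (\<Sum>\<^sub># \<T>) \<le> k * order G"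
    using disjoint_zero_sums_exist[OF fin] by blast
  have "\<Sum>\<^sub># (add_mset T \<T>) \<subseteq># S"
    using \<T>(2) T(1) by (simp add: subset_mset.le_diff_conv2 add.commute)
  then have "\<Sum>\<^sub># (add_mset T \<T>) = S"
    using \<T>(1) T by (intro M_set_disjoint_zero_sums_exhaust[OF S]) simp_all
  then have "size S = size T + size (\<Sum>\<^sub># \<T>)" by auto
  then show ?thesis using \<T>(3) by simp
next
  case False
  then show ?thesis using size_Diff_submset[OF T(1)] by simp
qed

lemma no_short_zero_sum_of_M_set:
  assumes fin: "finite (carrier G)" and "0 < k" and S: "S \<in> M_set G k"
    and size: "k * order G \<le> size S"
  shows "no_short_zero_sum G (order G) S"
  unfolding no_short_zero_sum_def
proof (intro allI impI)
  fix T assume "T \<subseteq># S" "T \<noteq> {#}" "zero_sum G T"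
  moreover obtain m where "k = Suc m" using \<open>0 < k\<close> gr0_implies_Suc by blast
  ultimately show "order G \<le> size T" using M_set_size_le[OF fin] S size by fastforce
qed

lemma no_short_zero_sum_terms_eq:
  assumes fin: "finite (carrier G)" and S: "seq_over G S"
    and free: "no_short_zero_sum G (order G) S" and size: "order G \<le> Suc (size S)"
    and gh: "g \<in># S" "h \<in># S"
  shows "g = h"
proof (rule ccontr)
  assume "g \<noteq> h"
  have carrier: "g \<in> carrier G" "h \<in> carrier G" using S gh by (auto simp: seq_over_def)
  have "card {g, h} \<le> order G" unfolding order_def using fin carrier by (intro card_mono) auto
  then have order: "1 < order G" using \<open>g \<noteq> h\<close> by simp
  have "h \<in># S - {#g#}" using gh \<open>g \<noteq> h\<close> by (simp add: in_diff_count)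
  then obtain ys where ys: "S = add_mset g (add_mset h (mset ys))"
    using gh by (metis insert_DiffM ex_mset)
  let ?xs = "g # h # ys" and ?xs' = "h # g # ys"
  have set: "set ?xs \<subseteq> carrier G" "set ?xs' \<subseteq> carrier G"
    using S ys by (auto simp: seq_over_def)
  have inj: "inj_on (prefix_sum G ?xs) {..<order G}" "inj_on (prefix_sum G ?xs') {..<order G}"
    using inj_on_prefix_sum set free size ys by (auto simp: add_mset_commute)
  obtain i where i: "i < order G" "g = prefix_sum G ?xs' i"
    using prefix_sum_image_eq_carrier[OF fin set(2) inj(2)] carrier(1) by blast
  show False
  proof (cases "i = 1")
    case True
    then show False using i(2) prefix_sum_Cons_1[OF carrier(2)] \<open>g \<noteq> h\<close> by simp
  next
    case False
    then have "prefix_sum G ?xs i = prefix_sum G ?xs 1"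
      using i(2) prefix_sum_swap_first_two[OF False, of G h g ys] prefix_sum_Cons_1[OF carrier(1)]
      by simp
    then show False using inj_onD[OF inj(1)] i(1) order False by blast
  qed
qed

lemma no_short_zero_sum_imp_generator_power:
  assumes fin: "finite (carrier G)" and S: "seq_over G S"
    and free: "no_short_zero_sum G (order G) S" and size: "order G \<le> size S"
  obtains g where "g \<in> carrier G" "ord g = order G" "S = replicate_mset (size S) g"
proof -
  have order: "0 < order G" using fin order_gt_0_iff_finite by simp
  then obtain g where gS: "g \<in># S" using size by (cases S) auto
  then have g: "g \<in> carrier G" using S by (auto simp: seq_over_def)
  have "set_mset S \<subseteq> {g}"
    using no_short_zero_sum_terms_eq[OF fin S free le_SucI[OF size]] gS by blast
  then have S_eq: "S = replicate_mset (size S) g" by (rule set_mset_subset_singletonD)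
  have le: "ord g \<le> order G" using ord_dvd_group_order[OF g] order by (rule dvd_imp_le)
  have "no_short_zero_sum G (order G) (replicate_mset (size S) g)"
    using free S_eq by simp
  then have "order G \<le> ord g"
    using ord_ge_1[OF fin g] le size g by (simp add: no_short_zero_sum_replicate_mset_iff)
  then show thesis using that g le S_eq by simp
qed

lemma M_set_iff_generator_power:
  assumes fin: "finite (carrier G)" and "0 < k"
    and S: "zero_sum G S" and size: "size S = k * order G"
  shows "S \<in> M_set G k \<longleftrightarrow>
    (\<exists>g\<in>carrier G. ord g = order G \<and> S = replicate_mset (k * order G) g)"
proof
  assume "S \<in> M_set G k"
  then have "no_short_zero_sum G (order G) S"
    using no_short_zero_sum_of_M_set[OF fin \<open>0 < k\<close>] size by simp
  moreover have "seq_over G S" using S by (simp add: zero_sum_def)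
  moreover have "order G \<le> size S" using \<open>0 < k\<close> size by simp
  ultimately obtain g where "g \<in> carrier G" "ord g = order G" "S = replicate_mset (size S) g"
    using no_short_zero_sum_imp_generator_power[OF fin] by blast
  then show "\<exists>g\<in>carrier G. ord g = order G \<and> S = replicate_mset (k * order G) g"
    using size by auto
next
  assume "\<exists>g\<in>carrier G. ord g = order G \<and> S = replicate_mset (k * order G) g"
  moreover have "0 < order G" using fin order_gt_0_iff_finite by simp
  ultimately have "no_short_zero_sum G (order G) S"
    by (auto simp: no_short_zero_sum_replicate_mset_iff)
  then show "S \<in> M_set G k"
    using S size \<open>0 < order G\<close> by (intro M_setI_no_short_zero_sum) auto
qed

end

theorem theorem3p2:
  fixes G :: "('a, 'b) monoid_scheme" and k :: nat and S :: "'a multiset"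
  assumes "group G" and "finite (carrier G)" and "cyclic_group G"
    and "k \<ge> 1"
    and "zero_sum G S" and "size S = Davenport G k"
  shows "S \<in> M_set G k \<longleftrightarrow>
    (\<exists>g\<in>carrier G. group.ord G g = order G \<and> S = replicate_mset (k * order G) g)"
proof -
  interpret group G by fact
  interpret comm_group G
    using assms(3) by (rule cyclic_imp_abelian_group)
  have "size S = k * order G"
    using assms(6) Davenport_cyclic_group[OF assms(2,3)] by simp
  then show ?thesis
    using M_set_iff_generator_power assms(2,4,5) by simp
qed

end
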